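(* Let $\Lambda$ be a source-free, sink-free, row-finite $k$-graph with finitely many vertices, and let $\Gamma$ be the LiMaR-split of $\Lambda$ at $w$ of degree $B$. Then there exists a homeomorphism $h:\overline X_\Lambda\to\overline X_\Gamma$ such that $\overline\sigma_\Gamma^m\circ h(x)=h\circ\overline\sigma_\Lambda^m(x)$ for all $m\in\mathbb N^k$ and all $x\in\overline X_\Lambda$.
   Context: Let $\mathbb N=\{0,1,2,\dots\}$, let $\mathbf e_1,\dots,\mathbf e_k$ be the standard basis of $\mathbb N^k$, and $|\mathbf n|=\sum_i n_i$. A $k$-graph ($k\ge 1$) is a countable small category $\Lambda$ with a functor $d:\Lambda\to\mathbb N^k$ such that whenever $d(\lambda)=\mathbf m+\mathbf n$ there are unique $\mu,\nu\in\Lambda$ with $\lambda=\mu\nu$, $d(\mu)=\mathbf m$, $d(\nu)=\mathbf n$. Write $\Lambda^{\mathbf n}=d^{-1}(\mathbf n)$, $\Lambda^0=d^{-1}(\mathbf 0)$ (vertices, identified with objects), $\Lambda^1=\{\lambda:|d(\lambda)|=1\}$ (edges); $r,s$ are range and source ($\lambda\mu$ is defined iff $s(\lambda)=r(\mu)$); $v\Lambda^{\mathbf n}=\{\lambda\in\Lambda^{\mathbf n}:r(\lambda)=v\}$. $\Lambda$ is row-finite if every $v\Lambda^{\mathbf e_i}$ is finite, source-free if every $v\Lambda^{\mathbf e_i}$ is nonempty, and sink-free if for every $i$ every vertex is the source of some edge of degree $\mathbf e_i$. The 1-skeleton $G$ of $\Lambda$ is the directed graph $(\Lambda^0,\Lambda^1,r,s)$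 with edges coloured by $d$; $G^*$ is its category of finite paths $f_m\cdots f_1$ with $s(f_{i+1})=r(f_i)$; for paths $\lambda,\mu\in G^*$, $\lambda\sim\mu$ means they have the same composite in $\Lambda$ (so $\Lambda=G^*/\!\sim$). LiMaR-split. Fix $B\in\{\mathbf e_1,\dots,\mathbf e_k\}$ and put $A=\{\mathbf e_1,\dots,\mathbf e_k\}\setminus\{B\}$. Write $s_B^{-1}(v)=\{e\in\Lambda^1:d(e)=B,\ s(e)=v\}$. Fix $w\in\Lambda^0$ with $|s_B^{-1}(w)|\ge2$. Let $S_w\subseteq\Lambda^0$ be the smallest set such that $w\in S_w$, and such that if $x\in S_w$ and $e\in\Lambda^1$ with $d(e)\in A$, $s(e)=x$, $|s_B^{-1}(r(e))|\ge2$, then $r(e)\in S_w$. Define $n:\Lambda^0\to\mathbb N$ by $n(v)=|s_B^{-1}(v)|$ if $v\in S_w$ and $n(v)=1$ otherwise. For each $v$ with $s_B^{-1}(v)\ne\emptyset$ fix a partition $s_B^{-1}(v)=\mathcal E^v_1\sqcup\dots\sqcup\mathcal E^v_{n(v)}$ into nonempty sets. The directed graph $G_L=(\Gamma^0,\Gamma^1,r_\Gamma,s_\Gamma)$ has $\Gamma^0=\{v^i:v\in\Lambda^0,1\le i\le n(v)\}$, $\Gamma^1=\{e^i:e\in\Lambda^1,1\le i\le n(r(e))\}$, $r_\Gamma(e^i)=r(e)^i$, and $s_\Gamma(e^i)=s(e)^j$ where: (1) if $d(e)=B$, $j$ is the index with $e\in\mathcal E^{s(e)}_j$; (2) if $d(e)\in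 A$ and $s_B^{-1}(r(e))\neq\emptyset$, choose $f\in\mathcal E^{r(e)}_i$, let $ac$ be the path with $fe\sim ac$, $d(c)=B$, $d(a)=d(e)$, and $j$ is the index with $c\in\mathcal E_j^{s(c)}$ (this does not depend on the choice of $f$); (3) otherwise $j=1$. Let $par:G_L\to G$, $par(e^i)=e$, $par(v^i)=v$, extended to paths; $d_\Gamma(e^i)=d(e)$, extended additively to paths. For paths $\lambda,\mu\in G_L^*$ put $\lambda\sim_L\mu$ iff $par(\lambda)\sim par(\mu)$, $r_\Gamma(\lambda)=r_\Gamma(\mu)$ and $s_\Gamma(\lambda)=s_\Gamma(\mu)$. The LiMaR-split of $\Lambda$ at $w$ of degree $B$ is $\Gamma=G_L^*/\!\sim_L$ with degree map $d_\Gamma$; under the hypotheses of the claim it is a row-finite, source-free $k$-graph. Two-sided path space. $\overline\Omega_k=\{(m,n)\in\mathbb Z^k\times\mathbb Z^k:m\le n\}$ is the category (with the factorization property) having $d(m,n)=n-m$, $r(m,n)=(m,m)$, $s(m,n)=(n,n)$ and composition $(m,n)(n,p)=(m,p)$. For a $k$-graph $\Lambda$, $\overline X_\Lambda$ is the set of all $k$-graph morphisms (degree-preserving functors) $\overline\Omega_k\to\Lambda$, with the topology generated by the sets $\mathcal Z((m,n),\lambda)=\{x\in\overline X_\Lambda:x(m,n)=\lambda\}$, $(m,n)\in\overline\Omega_k$, $\lambda\in\Lambda^{n-m}$. For $m\in\mathbb N^k$, $\overline\sigma_\Lambda^m:\overline X_\Lambda\to\overline X_\Lambda$ is the homeomorphism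 $\overline\sigma_\Lambda^m(x)(p,q)=x(p+m,q+m)$. *)

theory Defs
  imports
    "HOL-Analysis.Analysis"
    "HOL-Library.Disjoint_Sets"
    "Graph_Theory.Arc_Walk"
begin

section \<open>Categories with a degree map and k-graphs\<close>

text \<open>
  The number k is the cardinality of the finite index type \<open>'k\<close>, and the standard basis vector
  with index i is \<open>axis i 1\<close>.

  Categories are given by their morphisms alone; an object is identified with its identity
  morphism, so \<open>rng\<close> and \<open>src\<close> send a morphism to an identity morphism.  The composite
  \<open>cmp \<Lambda> f g\<close> is meaningful only if \<open>src \<Lambda> f = rng \<Lambda> g\<close>.
\<close>

record ('a, 'k :: finite) graded_cat =
  mor :: "'a set"
  rng :: "'a \<Rightarrow> 'a"
  src :: "'a \<Rightarrow> 'a"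
  cmp :: "'a \<Rightarrow> 'a \<Rightarrow> 'a"
  deg :: "'a \<Rightarrow> nat ^ 'k"

locale small_category =
  fixes \<Lambda> :: "('a, 'k :: finite) graded_cat"
  assumes rng_closed: "f \<in> mor \<Lambda> \<Longrightarrow> rng \<Lambda> f \<in> mor \<Lambda>"
    and src_closed: "f \<in> mor \<Lambda> \<Longrightarrow> src \<Lambda> f \<in> mor \<Lambda>"
    and rng_rng: "f \<in> mor \<Lambda> \<Longrightarrow> rng \<Lambda> (rng \<Lambda> f) = rng \<Lambda> f"
    and src_rng: "f \<in> mor \<Lambda> \<Longrightarrow> src \<Lambda> (rng \<Lambda> f) = rng \<Lambda> f"
    and rng_src: "f \<in> mor \<Lambda> \<Longrightarrow> rng \<Lambda> (src \<Lambda> f) = src \<Lambda> f"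
    and src_src: "f \<in> mor \<Lambda> \<Longrightarrow> src \<Lambda> (src \<Lambda> f) = src \<Lambda> f"
    and cmp_closed:
      "\<lbrakk>f \<in> mor \<Lambda>; g \<in> mor \<Lambda>; src \<Lambda> f = rng \<Lambda> g\<rbrakk> \<Longrightarrow> cmp \<Lambda> f g \<in> mor \<Lambda>"
    and rng_cmp:
      "\<lbrakk>f \<in> mor \<Lambda>; g \<in> mor \<Lambda>; src \<Lambda> f = rng \<Lambda> g\<rbrakk> \<Longrightarrow> rng \<Lambda> (cmp \<Lambda> f g) = rng \<Lambda> f"
    and src_cmp:
      "\<lbrakk>f \<in> mor \<Lambda>; g \<in> mor \<Lambda>; src \<Lambda> f = rng \<Lambda> g\<rbrakk> \<Longrightarrow> src \<Lambda> (cmp \<Lambda> f g) = src \<Lambda> g"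
    and cmp_rng: "f \<in> mor \<Lambda> \<Longrightarrow> cmp \<Lambda> (rng \<Lambda> f) f = f"
    and cmp_src: "f \<in> mor \<Lambda> \<Longrightarrow> cmp \<Lambda> f (src \<Lambda> f) = f"
    and cmp_assoc:
      "\<lbrakk>f \<in> mor \<Lambda>; g \<in> mor \<Lambda>; h \<in> mor \<Lambda>; src \<Lambda> f = rng \<Lambda> g; src \<Lambda> g = rng \<Lambda> h\<rbrakk>
        \<Longrightarrow> cmp \<Lambda> (cmp \<Lambda> f g) h = cmp \<Lambda> f (cmp \<Lambda> g h)"

locale kgraph = small_category \<Lambda>
  for \<Lambda> :: "('a, 'k :: finite) graded_cat" +
  assumes countable_mor: "countable (mor \<Lambda>)"
    and deg_rng: "f \<in> mor \<Lambda> \<Longrightarrow> deg \<Lambda> (rng \<Lambda> f) = 0"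
    and deg_src: "f \<in> mor \<Lambda> \<Longrightarrow> deg \<Lambda> (src \<Lambda> f) = 0"
    and deg_cmp:
      "\<lbrakk>f \<in> mor \<Lambda>; g \<in> mor \<Lambda>; src \<Lambda> f = rng \<Lambda> g\<rbrakk>
        \<Longrightarrow> deg \<Lambda> (cmp \<Lambda> f g) = deg \<Lambda> f + deg \<Lambda> g"
    and factorization:
      "\<lbrakk>f \<in> mor \<Lambda>; deg \<Lambda> f = m + n\<rbrakk>
        \<Longrightarrow> \<exists>!(\<mu>, \<nu>). \<mu> \<in> mor \<Lambda> \<and> \<nu> \<in> mor \<Lambda> \<and> src \<Lambda> \<mu> = rng \<Lambda> \<nu> \<and>
              f = cmp \<Lambda> \<mu> \<nu> \<and> deg \<Lambda> \<mu> = m \<and> deg \<Lambda> \<nu> = n"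

definition mor_deg :: "('a, 'k :: finite) graded_cat \<Rightarrow> nat ^ 'k \<Rightarrow> 'a set" where
  "mor_deg \<Lambda> n = {\<kappa> \<in> mor \<Lambda>. deg \<Lambda> \<kappa> = n}"

abbreviation vertices :: "('a, 'k :: finite) graded_cat \<Rightarrow> 'a set" where
  "vertices \<Lambda> \<equiv> mor_deg \<Lambda> 0"

definition edges :: "('a, 'k :: finite) graded_cat \<Rightarrow> 'a set" where
  "edges \<Lambda> = {\<kappa> \<in> mor \<Lambda>. (\<Sum>i\<in>UNIV. deg \<Lambda> \<kappa> $ i) = 1}"

definition std_basis :: "(nat ^ 'k :: finite) set" where
  "std_basis = range (\<lambda>i. axis i 1)"

definition row_finite :: "('a, 'k :: finite) graded_cat \<Rightarrow> bool" where
  "row_finite \<Lambda> \<longleftrightarrow>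
    (\<forall>v \<in> vertices \<Lambda>. \<forall>b \<in> std_basis. finite {\<kappa> \<in> mor_deg \<Lambda> b. rng \<Lambda> \<kappa> = v})"

definition source_free :: "('a, 'k :: finite) graded_cat \<Rightarrow> bool" where
  "source_free \<Lambda> \<longleftrightarrow>
    (\<forall>v \<in> vertices \<Lambda>. \<forall>b \<in> std_basis. {\<kappa> \<in> mor_deg \<Lambda> b. rng \<Lambda> \<kappa> = v} \<noteq> {})"

definition sink_free :: "('a, 'k :: finite) graded_cat \<Rightarrow> bool" where
  "sink_free \<Lambda> \<longleftrightarrow>
    (\<forall>b \<in> std_basis. \<forall>v \<in> vertices \<Lambda>. \<exists>e \<in> mor_deg \<Lambda> b. src \<Lambda> e = v)"


section \<open>Paths in directed graphs\<close>

text \<open>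
  An edge e of a directed graph points from its source \<open>tail G e\<close> to its range \<open>head G e\<close>.  A finite
  path is a triple (source, edges, range).  Its edges are listed in the order in which they are
  traversed: the path written \<open>f\<^sub>m \<cdots> f\<^sub>1\<close> in composition order has the edge list
  \<open>[f\<^sub>1, \<dots>, f\<^sub>m]\<close>.
\<close>

type_synonym ('v, 'e) gpath = "'v \<times> 'e list \<times> 'v"

definition gpaths :: "('v, 'e) pre_digraph \<Rightarrow> ('v, 'e) gpath set" where
  "gpaths G = {(u, p, v). pre_digraph.awalk G u p v}"

definition path_src :: "('v, 'e) gpath \<Rightarrow> 'v" where
  "path_src = (\<lambda>(u, p, v). u)"

definition path_rng :: "('v, 'e) gpath \<Rightarrow> 'v" where
  "path_rng = (\<lambda>(u, p, v). v)"

definition path_id :: "'v \<Rightarrow> ('v, 'e) gpath" where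
  "path_id v = (v, [], v)"

definition path_cmp :: "('v, 'e) gpath \<Rightarrow> ('v, 'e) gpath \<Rightarrow> ('v, 'e) gpath" where
  "path_cmp = (\<lambda>(u, p, v) (u', p', v'). (u', p' @ p, v))"

definition skeleton :: "('a, 'k :: finite) graded_cat \<Rightarrow> ('a, 'a) pre_digraph" where
  "skeleton \<Lambda> = \<lparr>verts = vertices \<Lambda>, arcs = edges \<Lambda>, tail = src \<Lambda>, head = rng \<Lambda>\<rparr>"

definition path_composite :: "('a, 'k :: finite) graded_cat \<Rightarrow> ('a, 'a) gpath \<Rightarrow> 'a" where
  "path_composite \<Lambda> = (\<lambda>(u, p, v). fold (cmp \<Lambda>) p u)"

definition path_equiv :: "('a, 'k :: finite) graded_cat \<Rightarrow> ('a, 'a) gpath rel" where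
  "path_equiv \<Lambda> = {(\<kappa>, \<mu>). \<kappa> \<in> gpaths (skeleton \<Lambda>) \<and> \<mu> \<in> gpaths (skeleton \<Lambda>) \<and>
     path_composite \<Lambda> \<kappa> = path_composite \<Lambda> \<mu>}"


section \<open>The LiMaR-split\<close>

definition src_inv :: "('a, 'k :: finite) graded_cat \<Rightarrow> nat ^ 'k \<Rightarrow> 'a \<Rightarrow> 'a set" where
  "src_inv \<Lambda> B v = {e \<in> edges \<Lambda>. deg \<Lambda> e = B \<and> src \<Lambda> e = v}"

text \<open>
  Cardinalities of the sets \<open>src_inv \<Lambda> B v\<close> are taken with \<^const>\<open>card\<close>, which is 0 on infinite
  sets.  In a row-finite k-graph with finitely many vertices all these sets are finite.
\<close>

inductive_set split_set :: "('a, 'k :: finite) graded_cat \<Rightarrow> nat ^ 'k \<Rightarrow> 'a \<Rightarrow> 'a set"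
  for \<Lambda> :: "('a, 'k :: finite) graded_cat" and B :: "nat ^ 'k" and w :: 'a
  where
    base: "w \<in> split_set \<Lambda> B w"
  | step: "\<lbrakk>x \<in> split_set \<Lambda> B w; e \<in> edges \<Lambda>; deg \<Lambda> e \<in> std_basis - {B}; src \<Lambda> e = x;
            card (src_inv \<Lambda> B (rng \<Lambda> e)) \<ge> 2\<rbrakk> \<Longrightarrow> rng \<Lambda> e \<in> split_set \<Lambda> B w"

definition split_num :: "('a, 'k :: finite) graded_cat \<Rightarrow> nat ^ 'k \<Rightarrow> 'a \<Rightarrow> 'a \<Rightarrow> nat" where
  "split_num \<Lambda> B w v = (if v \<in> split_set \<Lambda> B w then card (src_inv \<Lambda> B v) else 1)"

text \<open>The partition is the family of sets \<open>\<E> v i\<close> with \<open>1 \<le> i \<le> split_num \<Lambda> B w v\<close>.\<close>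

definition split_partition ::
    "('a, 'k :: finite) graded_cat \<Rightarrow> nat ^ 'k \<Rightarrow> 'a \<Rightarrow> ('a \<Rightarrow> nat \<Rightarrow> 'a set) \<Rightarrow> bool" where
  "split_partition \<Lambda> B w \<E> \<longleftrightarrow>
    (\<forall>v \<in> vertices \<Lambda>. src_inv \<Lambda> B v \<noteq> {} \<longrightarrow>
      (\<Union>i \<in> {1..split_num \<Lambda> B w v}. \<E> v i) = src_inv \<Lambda> B v \<and>
      disjoint_family_on (\<E> v) {1..split_num \<Lambda> B w v} \<and>
      (\<forall>i \<in> {1..split_num \<Lambda> B w v}. \<E> v i \<noteq> {}))"

definition part_index ::
    "('a, 'k :: finite) graded_cat \<Rightarrow> nat ^ 'k \<Rightarrow> 'a \<Rightarrow> ('a \<Rightarrow> nat \<Rightarrow> 'a set) \<Rightarrow> 'a \<Rightarrow> nat" where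
  "part_index \<Lambda> B w \<E> c =
    (THE j. j \<in> {1..split_num \<Lambda> B w (src \<Lambda> c)} \<and> c \<in> \<E> (src \<Lambda> c) j)"

text \<open>\<open>swap_edge \<Lambda> B f e\<close> is the edge c of degree B for which \<open>f e \<sim> a c\<close> with \<open>d(a) = d(e)\<close>.\<close>

definition swap_edge :: "('a, 'k :: finite) graded_cat \<Rightarrow> nat ^ 'k \<Rightarrow> 'a \<Rightarrow> 'a \<Rightarrow> 'a" where
  "swap_edge \<Lambda> B f e =
    (THE c. \<exists>a. deg \<Lambda> c = B \<and> deg \<Lambda> a = deg \<Lambda> e \<and>
      ((src \<Lambda> e, [e, f], rng \<Lambda> f), (src \<Lambda> c, [c, a], rng \<Lambda> a)) \<in> path_equiv \<Lambda>)"

definition split_src ::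
    "('a, 'k :: finite) graded_cat \<Rightarrow> nat ^ 'k \<Rightarrow> 'a \<Rightarrow> ('a \<Rightarrow> nat \<Rightarrow> 'a set) \<Rightarrow>
     'a \<times> nat \<Rightarrow> 'a \<times> nat" where
  "split_src \<Lambda> B w \<E> = (\<lambda>(e, i). (src \<Lambda> e,
     if deg \<Lambda> e = B then part_index \<Lambda> B w \<E> e
     else if src_inv \<Lambda> B (rng \<Lambda> e) \<noteq> {} then
       part_index \<Lambda> B w \<E> (swap_edge \<Lambda> B (SOME f. f \<in> \<E> (rng \<Lambda> e) i) e)
     else 1))"

definition split_graph ::
    "('a, 'k :: finite) graded_cat \<Rightarrow> nat ^ 'k \<Rightarrow> 'a \<Rightarrow> ('a \<Rightarrow> nat \<Rightarrow> 'a set) \<Rightarrow>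
     ('a \<times> nat, 'a \<times> nat) pre_digraph" where
  "split_graph \<Lambda> B w \<E> =
    \<lparr>verts = {(v, i). v \<in> vertices \<Lambda> \<and> i \<in> {1..split_num \<Lambda> B w v}},
     arcs = {(e, i). e \<in> edges \<Lambda> \<and> i \<in> {1..split_num \<Lambda> B w (rng \<Lambda> e)}},
     tail = split_src \<Lambda> B w \<E>,
     head = (\<lambda>(e, i). (rng \<Lambda> e, i))\<rparr>"

definition par_path :: "('a \<times> nat, 'a \<times> nat) gpath \<Rightarrow> ('a, 'a) gpath" where
  "par_path = (\<lambda>(u, p, v). (fst u, map fst p, fst v))"

definition split_path_deg ::
    "('a, 'k :: finite) graded_cat \<Rightarrow> ('a \<times> nat, 'a \<times> nat) gpath \<Rightarrow> nat ^ 'k" where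
  "split_path_deg \<Lambda> = (\<lambda>(u, p, v). \<Sum>(e, i)\<leftarrow>p. deg \<Lambda> e)"

definition split_equiv ::
    "('a, 'k :: finite) graded_cat \<Rightarrow> nat ^ 'k \<Rightarrow> 'a \<Rightarrow> ('a \<Rightarrow> nat \<Rightarrow> 'a set) \<Rightarrow>
     ('a \<times> nat, 'a \<times> nat) gpath rel" where
  "split_equiv \<Lambda> B w \<E> = {(\<kappa>, \<mu>).
     \<kappa> \<in> gpaths (split_graph \<Lambda> B w \<E>) \<and> \<mu> \<in> gpaths (split_graph \<Lambda> B w \<E>) \<and>
     (par_path \<kappa>, par_path \<mu>) \<in> path_equiv \<Lambda> \<and>
     path_rng \<kappa> = path_rng \<mu> \<and> path_src \<kappa> = path_src \<mu>}"

text \<open>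
  The split is the quotient of the path category: morphisms are equivalence classes of paths, and
  the operations are applied to representatives.  A vertex is the class of an empty path.
\<close>

definition limar_split ::
    "('a, 'k :: finite) graded_cat \<Rightarrow> nat ^ 'k \<Rightarrow> 'a \<Rightarrow> ('a \<Rightarrow> nat \<Rightarrow> 'a set) \<Rightarrow>
     (('a \<times> nat, 'a \<times> nat) gpath set, 'k) graded_cat" where
  "limar_split \<Lambda> B w \<E> = (let R = split_equiv \<Lambda> B w \<E> in
    \<lparr>mor = gpaths (split_graph \<Lambda> B w \<E>) // R,
     rng = (\<lambda>X. \<Union>\<kappa>\<in>X. R `` {path_id (path_rng \<kappa>)}),
     src = (\<lambda>X. \<Union>\<kappa>\<in>X. R `` {path_id (path_src \<kappa>)}),
     cmp = (\<lambda>X Y. \<Union>\<kappa>\<in>X. \<Union>\<mu>\<in>Y. R `` {path_cmp \<kappa> \<mu>}),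
     deg = (\<lambda>X. the_elem (split_path_deg \<Lambda> ` X))\<rparr>)"


section \<open>The two-sided path space\<close>

definition Omega_bar :: "((int ^ 'k) \<times> (int ^ 'k), 'k :: finite) graded_cat" where
  "Omega_bar =
    \<lparr>mor = {(m, n). m \<le> n},
     rng = (\<lambda>(m, n). (m, m)),
     src = (\<lambda>(m, n). (n, n)),
     cmp = (\<lambda>(m, n) (n', p). (m, p)),
     deg = (\<lambda>(m, n). \<chi> i. nat (n $ i - m $ i))\<rparr>"

text \<open>
  Morphisms are extensional functions, i.e. they take the value \<^const>\<open>undefined\<close> outside the
  domain category, so that equality of functions is equality of functors.
\<close>

definition kgraph_morphisms ::
    "('a, 'k :: finite) graded_cat \<Rightarrow> ('b, 'k) graded_cat \<Rightarrow> ('a \<Rightarrow> 'b) set" where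
  "kgraph_morphisms \<Lambda> \<Gamma> = {x \<in> mor \<Lambda> \<rightarrow>\<^sub>E mor \<Gamma>.
     (\<forall>f \<in> mor \<Lambda>. x (rng \<Lambda> f) = rng \<Gamma> (x f)) \<and>
     (\<forall>f \<in> mor \<Lambda>. x (src \<Lambda> f) = src \<Gamma> (x f)) \<and>
     (\<forall>f \<in> mor \<Lambda>. \<forall>g \<in> mor \<Lambda>. src \<Lambda> f = rng \<Lambda> g \<longrightarrow> x (cmp \<Lambda> f g) = cmp \<Gamma> (x f) (x g)) \<and>
     (\<forall>f \<in> mor \<Lambda>. deg \<Gamma> (x f) = deg \<Lambda> f)}"

definition X_bar ::
    "('a, 'k :: finite) graded_cat \<Rightarrow> ((int ^ 'k) \<times> (int ^ 'k) \<Rightarrow> 'a) set" where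
  "X_bar \<Lambda> = kgraph_morphisms Omega_bar \<Lambda>"

definition cylinder ::
    "('a, 'k :: finite) graded_cat \<Rightarrow> (int ^ 'k) \<times> (int ^ 'k) \<Rightarrow> 'a \<Rightarrow>
     ((int ^ 'k) \<times> (int ^ 'k) \<Rightarrow> 'a) set" where
  "cylinder \<Lambda> mn \<kappa> = {x \<in> X_bar \<Lambda>. x mn = \<kappa>}"

definition X_bar_topology ::
    "('a, 'k :: finite) graded_cat \<Rightarrow> ((int ^ 'k) \<times> (int ^ 'k) \<Rightarrow> 'a) topology" where
  "X_bar_topology \<Lambda> = topology_generated_by
     {cylinder \<Lambda> mn \<kappa> | mn \<kappa>. mn \<in> mor Omega_bar \<and> \<kappa> \<in> mor_deg \<Lambda> (deg Omega_bar mn)}"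

text \<open>
  The formula for the shift does not mention the k-graph, so a single function serves for all of
  them; restriction keeps the shifted morphism extensional.
\<close>

definition shift_bar ::
    "nat ^ 'k :: finite \<Rightarrow> ((int ^ 'k) \<times> (int ^ 'k) \<Rightarrow> 'a) \<Rightarrow>
     ((int ^ 'k) \<times> (int ^ 'k) \<Rightarrow> 'a)" where
  "shift_bar m x = (let m' = (\<chi> i. int (m $ i)) in
     restrict (\<lambda>(p, q). x (p + m', q + m')) (mor Omega_bar))"

end

theory Submission
  imports Defs
begin

text \<open>
  The copies of a vertex v in the split are indexed by the parts of a partition of the edges of
  degree B with source v.  A two-sided path x arrives at each of its vertices \<open>x(n, n)\<close> along one
  particular edge of degree B, namely \<open>x(n - B, n)\<close>.  So x itself selects a copy of \<open>x(n, n)\<close>, the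
  one indexed by the part that contains \<open>x(n - B, n)\<close>, and the homeomorphism sends x to its lift
  through the selected copies.

  These choices fit together by the rule for sources in the split graph.  For a basis vector b, the
  edges \<open>f = x(m - B, m)\<close> and \<open>c = x(m + b - B, m + b)\<close> are the sides of degree B of the commuting
  square of degree \<open>b + B\<close> of x at \<open>m - B\<close>, and \<open>e = x(m, m + b)\<close> is the side that joins their
  sources.  The lift of e that ends at the copy selected by f starts, by definition, at the copy
  indexed by the part of c, which is the copy that x selects at \<open>m + b\<close>
  (\<open>split_src_square\<close>, \<open>split_src_label\<close>).  That definition uses an arbitrary representative of the
  part of f; \<open>swap_index_choice_independent\<close> shows that the representative does not matter.  Hence
  every edge of x lifts, and so does every finite piece \<open>x(m, n)\<close>, because a morphism of the split
  is the same thing as a morphism of \<open>\<Lambda>\<close> together with copies of its range and source that are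
  joined by a lifted path (\<open>split_class\<close>).

  The inverse forgets the copies.  It is an inverse since a lifted edge of degree B starts at the
  copy indexed by its own part (\<open>split_class_deg_B_src\<close>): if y is a two-sided path in the split,
  the edge \<open>y(n - B, n)\<close> forces the copy at n to be the one that its projection selects.

  Both maps are local.  The lift at \<open>(m, n)\<close> depends only on \<open>x(m, n)\<close>, its ends and the edges of
  degree B arriving at them, and the projection at \<open>(m, n)\<close> depends only on \<open>y(m, n)\<close>.  So both
  are continuous, and since the rule is the same at all positions they commute with shifts.
\<close>

section \<open>Identities, factorizations and composites in a k-graph\<close>

context kgraph
begin

lemma rng_vertex: "f \<in> mor \<Lambda> \<Longrightarrow> rng \<Lambda> f \<in> vertices \<Lambda>"
  by (simp add: mor_deg_def rng_closed deg_rng)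

lemma src_vertex: "f \<in> mor \<Lambda> \<Longrightarrow> src \<Lambda> f \<in> vertices \<Lambda>"
  by (simp add: mor_deg_def src_closed deg_src)

lemma factorization_unique:
  assumes "\<mu> \<in> mor \<Lambda>" "\<nu> \<in> mor \<Lambda>" "src \<Lambda> \<mu> = rng \<Lambda> \<nu>"
    and "\<mu>' \<in> mor \<Lambda>" "\<nu>' \<in> mor \<Lambda>" "src \<Lambda> \<mu>' = rng \<Lambda> \<nu>'"
    and "cmp \<Lambda> \<mu> \<nu> = cmp \<Lambda> \<mu>' \<nu>'" "deg \<Lambda> \<mu> = deg \<Lambda> \<mu>'" "deg \<Lambda> \<nu> = deg \<Lambda> \<nu>'"
  shows "\<mu> = \<mu>' \<and> \<nu> = \<nu>'"
proof -
  have "\<exists>!(\<alpha>, \<beta>). \<alpha> \<in> mor \<Lambda> \<and> \<beta> \<in> mor \<Lambda> \<and> src \<Lambda> \<alpha> = rng \<Lambda> \<beta> \<and>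
      cmp \<Lambda> \<mu> \<nu> = cmp \<Lambda> \<alpha> \<beta> \<and> deg \<Lambda> \<alpha> = deg \<Lambda> \<mu> \<and> deg \<Lambda> \<beta> = deg \<Lambda> \<nu>"
    using factorization[of "cmp \<Lambda> \<mu> \<nu>" "deg \<Lambda> \<mu>" "deg \<Lambda> \<nu>"] assms(1-3)
    by (simp add: cmp_closed deg_cmp)
  then obtain z where z: "\<And>z'. (case z' of (\<alpha>, \<beta>) \<Rightarrow> \<alpha> \<in> mor \<Lambda> \<and> \<beta> \<in> mor \<Lambda> \<and>
      src \<Lambda> \<alpha> = rng \<Lambda> \<beta> \<and> cmp \<Lambda> \<mu> \<nu> = cmp \<Lambda> \<alpha> \<beta> \<and>
      deg \<Lambda> \<alpha> = deg \<Lambda> \<mu> \<and> deg \<Lambda> \<beta> = deg \<Lambda> \<nu>) \<Longrightarrow> z' = z"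
    by (elim ex1E) blast
  show ?thesis using z[of "(\<mu>, \<nu>)"] z[of "(\<mu>', \<nu>')"] assms by simp
qed

text \<open>
  A morphism v of degree 0 has the two factorizations \<open>v = r(v) v = v s(v)\<close> into factors of
  degree 0, so they agree.
\<close>

lemma vertex_is_identity:
  assumes "v \<in> vertices \<Lambda>"
  shows "rng \<Lambda> v = v" "src \<Lambda> v = v"
proof -
  have v: "v \<in> mor \<Lambda>" "deg \<Lambda> v = 0" using assms by (auto simp: mor_deg_def)
  have "rng \<Lambda> v = v \<and> v = src \<Lambda> v"
    by (rule factorization_unique)
      (use v in \<open>auto simp: rng_closed src_closed src_rng rng_src cmp_rng cmp_src deg_rng deg_src\<close>)
  then show "rng \<Lambda> v = v" "src \<Lambda> v = v" by auto
qed

text \<open>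
  Starting the fold at an arbitrary g instead of the identity at u is what makes the induction
  work, since processing the first edge e replaces g by \<open>e g\<close>.  Associativity then pulls g out.
\<close>

lemma fold_cmp_walk:
  assumes "pre_digraph.awalk (skeleton \<Lambda>) u p v" "g \<in> mor \<Lambda>" "rng \<Lambda> g = u"
  shows "fold (cmp \<Lambda>) p g \<in> mor \<Lambda> \<and> rng \<Lambda> (fold (cmp \<Lambda>) p g) = v \<and>
    src \<Lambda> (fold (cmp \<Lambda>) p g) = src \<Lambda> g \<and>
    fold (cmp \<Lambda>) p g = cmp \<Lambda> (fold (cmp \<Lambda>) p u) g \<and>
    deg \<Lambda> (fold (cmp \<Lambda>) p g) = sum_list (map (deg \<Lambda>) p) + deg \<Lambda> g"
  using assms
proof (induction p arbitrary: u g)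
  case Nil
  then show ?case
    by (auto simp: pre_digraph.awalk_def pre_digraph.cas.simps cmp_rng)
next
  case (Cons e p)
  then have e: "e \<in> mor \<Lambda>" "src \<Lambda> e = u"
    and p: "pre_digraph.awalk (skeleton \<Lambda>) (rng \<Lambda> e) p v"
    by (auto simp: pre_digraph.awalk_def pre_digraph.cas.simps skeleton_def edges_def rng_vertex)
  have eg: "cmp \<Lambda> e g \<in> mor \<Lambda>" "rng \<Lambda> (cmp \<Lambda> e g) = rng \<Lambda> e" "src \<Lambda> (cmp \<Lambda> e g) = src \<Lambda> g"
    "deg \<Lambda> (cmp \<Lambda> e g) = deg \<Lambda> e + deg \<Lambda> g"
    using e Cons.prems by (auto simp: cmp_closed rng_cmp src_cmp deg_cmp)
  have eu: "cmp \<Lambda> e u = e" using e cmp_src by auto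
  let ?q = "fold (cmp \<Lambda>) p (rng \<Lambda> e)"
  have q: "?q \<in> mor \<Lambda>" "src \<Lambda> ?q = rng \<Lambda> e"
    using Cons.IH[OF p, of "rng \<Lambda> e"] e by (auto simp: rng_closed rng_rng src_rng)
  note pe = Cons.IH[OF p e(1) refl] and peg = Cons.IH[OF p eg(1,2)]
  have "fold (cmp \<Lambda>) p e = cmp \<Lambda> ?q e" using pe by blast
  moreover have "fold (cmp \<Lambda>) p (cmp \<Lambda> e g) = cmp \<Lambda> ?q (cmp \<Lambda> e g)" using peg by blast
  ultimately have "fold (cmp \<Lambda>) p (cmp \<Lambda> e g) = cmp \<Lambda> (fold (cmp \<Lambda>) p e) g"
    using q e Cons.prems(2,3) by (simp only: cmp_assoc)
  moreover have "deg \<Lambda> (fold (cmp \<Lambda>) p (cmp \<Lambda> e g)) =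
      sum_list (map (deg \<Lambda>) (e # p)) + deg \<Lambda> g"
  proof -
    have "deg \<Lambda> (fold (cmp \<Lambda>) p (cmp \<Lambda> e g)) = sum_list (map (deg \<Lambda>) p) + deg \<Lambda> (cmp \<Lambda> e g)"
      using peg by blast
    then show ?thesis using eg(4) by (simp add: ac_simps)
  qed
  moreover have "fold (cmp \<Lambda>) (e # p) u = fold (cmp \<Lambda>) p e" by (simp add: eu)
  moreover have "fold (cmp \<Lambda>) (e # p) g = fold (cmp \<Lambda>) p (cmp \<Lambda> e g)" by simp
  ultimately show ?case using peg eg(3) by argo
qed

lemma path_composite_props:
  assumes "\<kappa> \<in> gpaths (skeleton \<Lambda>)"
  shows "path_composite \<Lambda> \<kappa> \<in> mor \<Lambda>" "rng \<Lambda> (path_composite \<Lambda> \<kappa>) = path_rng \<kappa>"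
    "src \<Lambda> (path_composite \<Lambda> \<kappa>) = path_src \<kappa>"
    "deg \<Lambda> (path_composite \<Lambda> \<kappa>) = sum_list (map (deg \<Lambda>) (fst (snd \<kappa>)))"
proof -
  obtain u p v where \<kappa>: "\<kappa> = (u, p, v)" "pre_digraph.awalk (skeleton \<Lambda>) u p v"
    using assms by (auto simp: gpaths_def)
  then have u: "u \<in> vertices \<Lambda>" by (auto simp: pre_digraph.awalk_def skeleton_def)
  then have "u \<in> mor \<Lambda>" "rng \<Lambda> u = u" "src \<Lambda> u = u" "deg \<Lambda> u = 0"
    using vertex_is_identity[OF u] by (auto simp: mor_deg_def)
  then show "path_composite \<Lambda> \<kappa> \<in> mor \<Lambda>" "rng \<Lambda> (path_composite \<Lambda> \<kappa>) = path_rng \<kappa>"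
    "src \<Lambda> (path_composite \<Lambda> \<kappa>) = path_src \<kappa>"
    "deg \<Lambda> (path_composite \<Lambda> \<kappa>) = sum_list (map (deg \<Lambda>) (fst (snd \<kappa>)))"
    using fold_cmp_walk[OF \<kappa>(2), of u] \<kappa>(1)
    by (auto simp: path_composite_def path_rng_def path_src_def)
qed

end

lemma path_src_cmp: "path_src (path_cmp \<kappa> \<mu>) = path_src \<mu>"
  and path_rng_cmp: "path_rng (path_cmp \<kappa> \<mu>) = path_rng \<kappa>"
  by (auto simp: path_src_def path_rng_def path_cmp_def split: prod.splits)

lemma path_src_id [simp]: "path_src (path_id v) = v"
  and path_rng_id [simp]: "path_rng (path_id v) = v"
  by (auto simp: path_src_def path_rng_def path_id_def)

lemma cas_append:
  "pre_digraph.cas G u (p @ q) v \<longleftrightarrow> (\<exists>t. pre_digraph.cas G u p t \<and> pre_digraph.cas G t q v)"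
  by (induction p arbitrary: u) (auto simp: pre_digraph.cas.simps)

lemma path_cmp_in_gpaths:
  assumes "\<kappa> \<in> gpaths G" "\<mu> \<in> gpaths G" "path_src \<kappa> = path_rng \<mu>"
  shows "path_cmp \<kappa> \<mu> \<in> gpaths G"
  using assms
  by (auto simp: gpaths_def path_cmp_def path_src_def path_rng_def pre_digraph.awalk_def cas_append)

lemma path_id_in_gpaths: "path_id v \<in> gpaths G \<longleftrightarrow> v \<in> verts G"
  by (auto simp: gpaths_def path_id_def pre_digraph.awalk_def pre_digraph.cas.simps)

lemma (in kgraph) path_composite_cmp:
  assumes "\<kappa> \<in> gpaths (skeleton \<Lambda>)" "\<mu> \<in> gpaths (skeleton \<Lambda>)" "path_src \<kappa> = path_rng \<mu>"
  shows "path_composite \<Lambda> (path_cmp \<kappa> \<mu>) = cmp \<Lambda> (path_composite \<Lambda> \<kappa>) (path_composite \<Lambda> \<mu>)"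
proof -
  obtain u p v where \<kappa>: "\<kappa> = (u, p, v)" "pre_digraph.awalk (skeleton \<Lambda>) u p v"
    using assms by (auto simp: gpaths_def)
  obtain t q where \<mu>: "\<mu> = (t, q, u)" using assms(3) \<kappa>
    by (cases \<mu>) (auto simp: path_src_def path_rng_def)
  show ?thesis
    using fold_cmp_walk[OF \<kappa>(2), of "path_composite \<Lambda> \<mu>"] path_composite_props[OF assms(2)] \<mu> \<kappa>
    by (simp add: path_composite_def path_cmp_def path_rng_def)
qed

section \<open>The morphisms of the split\<close>

text \<open>
  A morphism of the split is a \<open>\<sim>\<^sub>L\<close>-class, and such a class is determined by the ends v and u of
  its paths and by the composite f in \<open>\<Lambda>\<close> of their images.
\<close>

definition split_class ::
    "('a, 'k :: finite) graded_cat \<Rightarrow> nat ^ 'k \<Rightarrow> 'a \<Rightarrow> ('a \<Rightarrow> nat \<Rightarrow> 'a set) \<Rightarrow>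
     'a \<times> nat \<Rightarrow> 'a \<Rightarrow> 'a \<times> nat \<Rightarrow> ('a \<times> nat, 'a \<times> nat) gpath set" where
  "split_class \<Lambda> B w \<E> v f u = {\<kappa> \<in> gpaths (split_graph \<Lambda> B w \<E>).
     path_rng \<kappa> = v \<and> path_composite \<Lambda> (par_path \<kappa>) = f \<and> path_src \<kappa> = u}"

definition base_mor ::
    "('a, 'k :: finite) graded_cat \<Rightarrow> ('a \<times> nat, 'a \<times> nat) gpath set \<Rightarrow> 'a" where
  "base_mor \<Lambda> X = path_composite \<Lambda> (par_path (SOME \<kappa>. \<kappa> \<in> X))"

lemma base_mor_split_class:
  assumes "split_class \<Lambda> B w \<E> v f u \<noteq> {}"
  shows "base_mor \<Lambda> (split_class \<Lambda> B w \<E> v f u) = f"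
proof -
  have "(SOME \<kappa>. \<kappa> \<in> split_class \<Lambda> B w \<E> v f u) \<in> split_class \<Lambda> B w \<E> v f u"
    using assms some_in_eq by blast
  then show ?thesis by (auto simp: base_mor_def split_class_def)
qed

lemma split_class_inject:
  assumes "split_class \<Lambda> B w \<E> v f u = split_class \<Lambda> B w \<E> v' f' u'"
    and "split_class \<Lambda> B w \<E> v f u \<noteq> {}"
  shows "v = v' \<and> f = f' \<and> u = u'"
proof -
  obtain \<kappa> where "\<kappa> \<in> split_class \<Lambda> B w \<E> v f u" using assms(2) by blast
  moreover from this have "\<kappa> \<in> split_class \<Lambda> B w \<E> v' f' u'" using assms(1) by simp
  ultimately show ?thesis by (auto simp: split_class_def)
qed

context kgraph
begin

lemma split_graph_head:
  assumes "e \<in> arcs (split_graph \<Lambda> B w \<E>)"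
  shows "head (split_graph \<Lambda> B w \<E>) e \<in> verts (split_graph \<Lambda> B w \<E>)"
  using assms by (auto simp: split_graph_def edges_def rng_vertex)

lemma split_walk_rng:
  assumes "\<kappa> \<in> gpaths (split_graph \<Lambda> B w \<E>)"
  shows "path_rng \<kappa> \<in> verts (split_graph \<Lambda> B w \<E>)"
proof -
  let ?G = "split_graph \<Lambda> B w \<E>"
  have "pre_digraph.awalk ?G u p v \<Longrightarrow> v \<in> verts ?G" for u p v
  proof (induction p arbitrary: u)
    case (Cons e p)
    then have "pre_digraph.awalk ?G (head ?G e) p v"
      using split_graph_head[of e B w \<E>]
      by (auto simp: pre_digraph.awalk_def pre_digraph.cas.simps)
    then show ?case by (rule Cons.IH)
  qed (auto simp: pre_digraph.awalk_def pre_digraph.cas.simps)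
  then show ?thesis using assms by (auto simp: gpaths_def path_rng_def)
qed

lemma par_path_in_gpaths:
  assumes "\<kappa> \<in> gpaths (split_graph \<Lambda> B w \<E>)"
  shows "par_path \<kappa> \<in> gpaths (skeleton \<Lambda>)"
proof -
  let ?G = "split_graph \<Lambda> B w \<E>"
  have "pre_digraph.awalk ?G u p v \<Longrightarrow> pre_digraph.awalk (skeleton \<Lambda>) (fst u) (map fst p) (fst v)"
    for u p v
  proof (induction p arbitrary: u)
    case (Cons e p)
    then have e: "e \<in> arcs ?G" "tail ?G e = u"
      and p: "pre_digraph.awalk ?G (head ?G e) p v"
      using split_graph_head[of e B w \<E>]
      by (auto simp: pre_digraph.awalk_def pre_digraph.cas.simps)
    obtain e' i where e': "e = (e', i)" by (cases e)
    have "fst e \<in> edges \<Lambda>" "src \<Lambda> (fst e) = fst u" "fst (head ?G e) = rng \<Lambda> (fst e)"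
      using e e' by (auto simp: split_graph_def split_src_def)
    moreover from this have "fst u \<in> vertices \<Lambda>" by (metis (lifting) edges_def mem_Collect_eq src_vertex)
    ultimately show ?case using Cons.IH[OF p]
      by (auto simp: pre_digraph.awalk_def pre_digraph.cas.simps skeleton_def)
  qed (auto simp: pre_digraph.awalk_def pre_digraph.cas.simps skeleton_def split_graph_def)
  then show ?thesis using assms by (auto simp: gpaths_def par_path_def)
qed

lemma split_class_props:
  assumes "\<kappa> \<in> split_class \<Lambda> B w \<E> v f u"
  shows "f \<in> mor \<Lambda>" "rng \<Lambda> f = fst v" "src \<Lambda> f = fst u"
    "deg \<Lambda> f = split_path_deg \<Lambda> \<kappa>"
    "v \<in> verts (split_graph \<Lambda> B w \<E>)" "u \<in> verts (split_graph \<Lambda> B w \<E>)"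
proof -
  have \<kappa>: "\<kappa> \<in> gpaths (split_graph \<Lambda> B w \<E>)" "path_rng \<kappa> = v" "path_src \<kappa> = u"
    "f = path_composite \<Lambda> (par_path \<kappa>)"
    using assms by (auto simp: split_class_def)
  note par = path_composite_props[OF par_path_in_gpaths[OF \<kappa>(1)]]
  have "split_path_deg \<Lambda> \<kappa> = sum_list (map (deg \<Lambda>) (fst (snd (par_path \<kappa>))))"
    by (auto simp: split_path_deg_def par_path_def o_def case_prod_unfold)
  then show "f \<in> mor \<Lambda>" "rng \<Lambda> f = fst v" "src \<Lambda> f = fst u" "deg \<Lambda> f = split_path_deg \<Lambda> \<kappa>"
    using par \<kappa> by (auto simp: par_path_def path_rng_def path_src_def split: prod.splits)
  show "v \<in> verts (split_graph \<Lambda> B w \<E>)" using split_walk_rng[OF \<kappa>(1)] \<kappa>(2) by simp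
  show "u \<in> verts (split_graph \<Lambda> B w \<E>)"
    using \<kappa> by (auto simp: gpaths_def path_src_def pre_digraph.awalk_def)
qed

lemma split_class_id:
  assumes "v \<in> verts (split_graph \<Lambda> B w \<E>)"
  shows "path_id v \<in> split_class \<Lambda> B w \<E> v (fst v) v"
  using assms
  by (auto simp: split_class_def path_id_in_gpaths) (simp add: path_id_def par_path_def path_composite_def)

lemma split_class_cmp:
  assumes "\<kappa> \<in> split_class \<Lambda> B w \<E> v f u" "\<mu> \<in> split_class \<Lambda> B w \<E> u g t"
  shows "path_cmp \<kappa> \<mu> \<in> split_class \<Lambda> B w \<E> v (cmp \<Lambda> f g) t"
proof -
  have "par_path (path_cmp \<kappa> \<mu>) = path_cmp (par_path \<kappa>) (par_path \<mu>)"
    by (auto simp: par_path_def path_cmp_def split: prod.splits)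
  moreover have "path_src (par_path \<kappa>) = path_rng (par_path \<mu>)"
    using assms by (auto simp: split_class_def par_path_def path_src_def path_rng_def split: prod.splits)
  ultimately show ?thesis
    using assms path_composite_cmp[of "par_path \<kappa>" "par_path \<mu>"]
    by (auto simp: split_class_def path_src_cmp path_rng_cmp path_cmp_in_gpaths par_path_in_gpaths)
qed

lemma split_equiv_Image:
  assumes "\<kappa> \<in> split_class \<Lambda> B w \<E> v f u"
  shows "split_equiv \<Lambda> B w \<E> `` {\<kappa>} = split_class \<Lambda> B w \<E> v f u"
  using assms by (auto simp: split_class_def split_equiv_def path_equiv_def par_path_in_gpaths)

text \<open>
  In these coordinates the quotient operations become the obvious ones: identities of the marked
  ends, composition in \<open>\<Lambda>\<close> of the middle components, and degree in \<open>\<Lambda>\<close>.  Representatives no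
  longer appear, which is how well-definedness of the unions in \<^const>\<open>limar_split\<close> enters.
\<close>

lemma limar_split_mor:
  "X \<in> mor (limar_split \<Lambda> B w \<E>) \<longleftrightarrow>
    (\<exists>v f u. X = split_class \<Lambda> B w \<E> v f u \<and> X \<noteq> {})"
proof
  assume "X \<in> mor (limar_split \<Lambda> B w \<E>)"
  then obtain \<kappa> where \<kappa>: "\<kappa> \<in> gpaths (split_graph \<Lambda> B w \<E>)" "X = split_equiv \<Lambda> B w \<E> `` {\<kappa>}"
    by (auto simp: limar_split_def Let_def quotient_def)
  then have "\<kappa> \<in> split_class \<Lambda> B w \<E> (path_rng \<kappa>) (path_composite \<Lambda> (par_path \<kappa>)) (path_src \<kappa>)"
    by (simp add: split_class_def)
  then show "\<exists>v f u. X = split_class \<Lambda> B w \<E> v f u \<and> X \<noteq> {}"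
    using split_equiv_Image \<kappa>(2) by blast
next
  assume "\<exists>v f u. X = split_class \<Lambda> B w \<E> v f u \<and> X \<noteq> {}"
  then obtain v f u where X: "X = split_class \<Lambda> B w \<E> v f u" "X \<noteq> {}" by blast
  then obtain \<kappa> where "\<kappa> \<in> split_class \<Lambda> B w \<E> v f u" by blast
  then show "X \<in> mor (limar_split \<Lambda> B w \<E>)"
    using split_equiv_Image[of \<kappa> B w \<E> v f u] X(1)
    by (auto simp: limar_split_def Let_def quotient_def split_class_def)
qed

lemma limar_split_rng:
  assumes "split_class \<Lambda> B w \<E> v f u \<noteq> {}"
  shows "rng (limar_split \<Lambda> B w \<E>) (split_class \<Lambda> B w \<E> v f u) = split_class \<Lambda> B w \<E> v (fst v) v"
proof -
  have "split_equiv \<Lambda> B w \<E> `` {path_id (path_rng \<kappa>)} = split_class \<Lambda> B w \<E> v (fst v) v"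
    if "\<kappa> \<in> split_class \<Lambda> B w \<E> v f u" for \<kappa>
    using split_equiv_Image[OF split_class_id[OF split_class_props(5)[OF that]]] that
    by (simp add: split_class_def)
  then show ?thesis using assms by (auto simp: limar_split_def Let_def)
qed

lemma limar_split_src:
  assumes "split_class \<Lambda> B w \<E> v f u \<noteq> {}"
  shows "src (limar_split \<Lambda> B w \<E>) (split_class \<Lambda> B w \<E> v f u) = split_class \<Lambda> B w \<E> u (fst u) u"
proof -
  have "split_equiv \<Lambda> B w \<E> `` {path_id (path_src \<kappa>)} = split_class \<Lambda> B w \<E> u (fst u) u"
    if "\<kappa> \<in> split_class \<Lambda> B w \<E> v f u" for \<kappa>
    using split_equiv_Image[OF split_class_id[OF split_class_props(6)[OF that]]] that
    by (simp add: split_class_def)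
  then show ?thesis using assms by (auto simp: limar_split_def Let_def)
qed

lemma limar_split_cmp:
  assumes "split_class \<Lambda> B w \<E> v f u \<noteq> {}" "split_class \<Lambda> B w \<E> u g t \<noteq> {}"
  shows "cmp (limar_split \<Lambda> B w \<E>) (split_class \<Lambda> B w \<E> v f u) (split_class \<Lambda> B w \<E> u g t) =
    split_class \<Lambda> B w \<E> v (cmp \<Lambda> f g) t"
proof -
  have "split_equiv \<Lambda> B w \<E> `` {path_cmp \<kappa> \<mu>} = split_class \<Lambda> B w \<E> v (cmp \<Lambda> f g) t"
    if "\<kappa> \<in> split_class \<Lambda> B w \<E> v f u" "\<mu> \<in> split_class \<Lambda> B w \<E> u g t" for \<kappa> \<mu>
    by (rule split_equiv_Image[OF split_class_cmp[OF that]])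
  then show ?thesis using assms by (auto simp: limar_split_def Let_def)
qed

lemma limar_split_deg:
  assumes "split_class \<Lambda> B w \<E> v f u \<noteq> {}"
  shows "deg (limar_split \<Lambda> B w \<E>) (split_class \<Lambda> B w \<E> v f u) = deg \<Lambda> f"
proof -
  have "split_path_deg \<Lambda> \<kappa> = deg \<Lambda> f" if "\<kappa> \<in> split_class \<Lambda> B w \<E> v f u" for \<kappa>
    using split_class_props(4)[OF that] by simp
  then have "split_path_deg \<Lambda> ` split_class \<Lambda> B w \<E> v f u = {deg \<Lambda> f}"
    using assms by (metis (no_types, lifting) image_cong image_constant_conv)
  then show ?thesis by (simp add: limar_split_def Let_def)
qed

end


section \<open>Labels of lifted edges\<close>

lemma sum_std_basis:
  assumes "b \<in> std_basis"
  shows "(\<Sum>i\<in>UNIV. b $ i) = 1"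
  using assms by (auto simp: std_basis_def axis_def if_distrib cong: if_cong)

lemma (in kgraph) edge_if_deg_std_basis:
  "f \<in> mor \<Lambda> \<Longrightarrow> deg \<Lambda> f \<in> std_basis \<Longrightarrow> f \<in> edges \<Lambda>"
  by (simp add: edges_def sum_std_basis)

text \<open>
  Finiteness makes the cardinalities that define the split set and the number of copies genuine
  ones; nonemptiness gives every vertex a partition and excludes the default index 1 in the
  definition of sources.
\<close>

locale partitioned_kgraph = kgraph \<Lambda>
  for \<Lambda> :: "('a, 'k :: finite) graded_cat" +
  fixes B :: "nat ^ 'k" and w :: 'a and \<E> :: "'a \<Rightarrow> nat \<Rightarrow> 'a set"
  assumes B_std: "B \<in> std_basis"
    and finite_src_inv: "v \<in> vertices \<Lambda> \<Longrightarrow> finite (src_inv \<Lambda> B v)"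
    and nonempty_src_inv: "v \<in> vertices \<Lambda> \<Longrightarrow> src_inv \<Lambda> B v \<noteq> {}"
    and partition: "split_partition \<Lambda> B w \<E>"
begin

abbreviation "split_gr \<equiv> split_graph \<Lambda> B w \<E>"
abbreviation "cls \<equiv> split_class \<Lambda> B w \<E>"
abbreviation "idx \<equiv> part_index \<Lambda> B w \<E>"
abbreviation "num \<equiv> split_num \<Lambda> B w"

lemma parts:
  assumes "v \<in> vertices \<Lambda>"
  shows "(\<Union>i \<in> {1..num v}. \<E> v i) = src_inv \<Lambda> B v"
    and "disjoint_family_on (\<E> v) {1..num v}"
    and "i \<in> {1..num v} \<Longrightarrow> \<E> v i \<noteq> {}"
  using partition nonempty_src_inv[OF assms] assms by (auto simp: split_partition_def)

lemma in_src_inv: "c \<in> src_inv \<Lambda> B v \<longleftrightarrow> c \<in> mor \<Lambda> \<and> deg \<Lambda> c = B \<and> src \<Lambda> c = v"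
  using B_std sum_std_basis by (auto simp: src_inv_def edges_def)

lemma part_index_eq:
  assumes "v \<in> vertices \<Lambda>" "j \<in> {1..num v}" "c \<in> \<E> v j"
  shows "idx c = j"
proof -
  have "c \<in> src_inv \<Lambda> B v" using assms parts(1)[OF assms(1)] by blast
  then have "src \<Lambda> c = v" by (simp add: in_src_inv)
  moreover have "(THE k. k \<in> {1..num v} \<and> c \<in> \<E> v k) = j"
  proof (rule the_equality)
    show "j \<in> {1..num v} \<and> c \<in> \<E> v j" using assms by blast
    show "k = j" if "k \<in> {1..num v} \<and> c \<in> \<E> v k" for k
      using assms that disjoint_family_onD[OF parts(2)[OF assms(1)], of k j] by blast
  qed
  ultimately show ?thesis by (simp only: part_index_def)
qed

lemma part_index_props:
  assumes "c \<in> mor \<Lambda>" "deg \<Lambda> c = B"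
  shows "idx c \<in> {1..num (src \<Lambda> c)}" "c \<in> \<E> (src \<Lambda> c) (idx c)"
proof -
  note v = src_vertex[OF assms(1)]
  have "c \<in> src_inv \<Lambda> B (src \<Lambda> c)" using assms by (simp add: in_src_inv)
  then obtain j where j: "j \<in> {1..num (src \<Lambda> c)}" "c \<in> \<E> (src \<Lambda> c) j"
    using parts(1)[OF v] by blast
  then have "idx c = j" by (rule part_index_eq[OF v])
  then show "idx c \<in> {1..num (src \<Lambda> c)}" "c \<in> \<E> (src \<Lambda> c) (idx c)" using j by auto
qed

lemma part_index_in_verts:
  assumes "c \<in> mor \<Lambda>" "deg \<Lambda> c = B"
  shows "(src \<Lambda> c, idx c) \<in> verts split_gr"
  using part_index_props(1)[OF assms] src_vertex[OF assms(1)] by (simp add: split_graph_def)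

text \<open>
  At a vertex y of the split set the edges of degree B are divided into as many nonempty parts as
  there are edges, so each part is a singleton.
\<close>

lemma parts_singleton:
  assumes y: "y \<in> vertices \<Lambda>" "y \<in> split_set \<Lambda> B w"
    and "f \<in> \<E> y i" "f' \<in> \<E> y i" "i \<in> {1..num y}"
  shows "f = f'"
proof -
  have "idx ` src_inv \<Lambda> B y = {1..num y}"
  proof (intro equalityI subsetI)
    fix i assume "i \<in> idx ` src_inv \<Lambda> B y"
    then show "i \<in> {1..num y}" using part_index_props(1) by (auto simp: in_src_inv)
  next
    fix i assume i: "i \<in> {1..num y}"
    then obtain c where "c \<in> \<E> y i" using parts(3)[OF y(1)] by blast
    then show "i \<in> idx ` src_inv \<Lambda> B y"
      using part_index_eq[OF y(1) i] parts(1)[OF y(1)] i by blast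
  qed
  then have "card (idx ` src_inv \<Lambda> B y) = card (src_inv \<Lambda> B y)"
    using y(2) by (simp add: split_num_def)
  then have "inj_on idx (src_inv \<Lambda> B y)"
    by (rule eq_card_imp_inj_on[OF finite_src_inv[OF y(1)]])
  moreover have "f \<in> src_inv \<Lambda> B y" "f' \<in> src_inv \<Lambda> B y"
    using parts(1)[OF y(1)] assms(3-5) by blast+
  moreover have "idx f = i" "idx f' = i"
    using part_index_eq[OF y(1)] assms(3-5) by auto
  ultimately show ?thesis by (auto dest: inj_onD)
qed

lemma two_edge_path:
  "(src \<Lambda> e, [e, f], rng \<Lambda> f) \<in> gpaths (skeleton \<Lambda>) \<longleftrightarrow>
    e \<in> edges \<Lambda> \<and> f \<in> edges \<Lambda> \<and> src \<Lambda> f = rng \<Lambda> e"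
  by (auto simp: gpaths_def pre_digraph.awalk_def pre_digraph.cas.simps skeleton_def edges_def
      src_vertex)

lemma two_edge_composite:
  "e \<in> mor \<Lambda> \<Longrightarrow> path_composite \<Lambda> (src \<Lambda> e, [e, f], rng \<Lambda> f) = cmp \<Lambda> f e"
  by (simp add: path_composite_def cmp_src)

text \<open>
  The edge c in the definition of \<^const>\<open>swap_edge\<close> is the factor of degree B in the factorization
  of \<open>f e\<close> in the opposite order of degrees, so it is unique.
\<close>

lemma swap_edge_eq:
  assumes mor: "f \<in> mor \<Lambda>" "e \<in> mor \<Lambda>" "a \<in> mor \<Lambda>" "c \<in> mor \<Lambda>"
    and src: "src \<Lambda> f = rng \<Lambda> e" "src \<Lambda> a = rng \<Lambda> c"
    and eq: "cmp \<Lambda> f e = cmp \<Lambda> a c"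
    and deg: "deg \<Lambda> f = B" "deg \<Lambda> c = B" "deg \<Lambda> a = deg \<Lambda> e" "deg \<Lambda> e \<in> std_basis"
  shows "swap_edge \<Lambda> B f e = c"
proof -
  have "e \<in> edges \<Lambda>" "f \<in> edges \<Lambda>" "a \<in> edges \<Lambda>" "c \<in> edges \<Lambda>"
    using mor deg B_std by (auto intro!: edge_if_deg_std_basis)
  then have c: "((src \<Lambda> e, [e, f], rng \<Lambda> f), (src \<Lambda> c, [c, a], rng \<Lambda> a)) \<in> path_equiv \<Lambda>"
    using src eq mor by (simp add: path_equiv_def two_edge_path two_edge_composite)
  have unique: "c' = c" if "deg \<Lambda> c' = B" "deg \<Lambda> a' = deg \<Lambda> e"
    "((src \<Lambda> e, [e, f], rng \<Lambda> f), (src \<Lambda> c', [c', a'], rng \<Lambda> a')) \<in> path_equiv \<Lambda>" for a' c'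
  proof -
    have "a' \<in> mor \<Lambda>" "c' \<in> mor \<Lambda>" "src \<Lambda> a' = rng \<Lambda> c'" "cmp \<Lambda> f e = cmp \<Lambda> a' c'"
      using that(3) mor
      by (auto simp: path_equiv_def two_edge_path two_edge_composite edges_def)
    then have "a' = a \<and> c' = c"
      by (intro factorization_unique) (use that(1,2) mor(3,4) src(2) eq deg(2,3) in simp_all)
    then show ?thesis by simp
  qed
  show ?thesis
    unfolding swap_edge_def
  proof (rule the_equality)
    show "\<exists>a. deg \<Lambda> c = B \<and> deg \<Lambda> a = deg \<Lambda> e \<and>
      ((src \<Lambda> e, [e, f], rng \<Lambda> f), (src \<Lambda> c, [c, a], rng \<Lambda> a)) \<in> path_equiv \<Lambda>"
      using c deg(2,3) by blast
  qed (use unique in blast)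
qed

lemma swap_edge_props:
  assumes mor: "f \<in> mor \<Lambda>" "e \<in> mor \<Lambda>" "src \<Lambda> f = rng \<Lambda> e"
    and deg: "deg \<Lambda> f = B" "deg \<Lambda> e \<in> std_basis"
  shows "swap_edge \<Lambda> B f e \<in> mor \<Lambda>" "deg \<Lambda> (swap_edge \<Lambda> B f e) = B"
    "src \<Lambda> (swap_edge \<Lambda> B f e) = src \<Lambda> e"
proof -
  have "cmp \<Lambda> f e \<in> mor \<Lambda>" "deg \<Lambda> (cmp \<Lambda> f e) = deg \<Lambda> e + B" "src \<Lambda> (cmp \<Lambda> f e) = src \<Lambda> e"
    using mor deg by (auto simp: cmp_closed deg_cmp src_cmp add.commute)
  moreover from this obtain a c where "a \<in> mor \<Lambda>" "c \<in> mor \<Lambda>" "src \<Lambda> a = rng \<Lambda> c"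
    "cmp \<Lambda> f e = cmp \<Lambda> a c" "deg \<Lambda> a = deg \<Lambda> e" "deg \<Lambda> c = B"
    using factorization[of "cmp \<Lambda> f e" "deg \<Lambda> e" B] by blast
  moreover from this have "swap_edge \<Lambda> B f e = c" using swap_edge_eq assms by blast
  ultimately show "swap_edge \<Lambda> B f e \<in> mor \<Lambda>" "deg \<Lambda> (swap_edge \<Lambda> B f e) = B"
    "src \<Lambda> (swap_edge \<Lambda> B f e) = src \<Lambda> e"
    by (auto simp: src_cmp)
qed

text \<open>
  If the source of e is outside the split set, all edges of degree B starting there have index 1.
  If the range of e is inside, f and f' agree since the parts there are singletons.  If only the
  source is inside, then e did not propagate the split set to its range, so at most one edge of
  degree B starts at the range.
\<close>

lemma swap_index_choice_independent:
  assumes e: "e \<in> mor \<Lambda>" "deg \<Lambda> e \<in> std_basis - {B}"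
    and i: "i \<in> {1..num (rng \<Lambda> e)}"
    and f: "f \<in> \<E> (rng \<Lambda> e) i" "f' \<in> \<E> (rng \<Lambda> e) i"
  shows "idx (swap_edge \<Lambda> B f e) = idx (swap_edge \<Lambda> B f' e)"
proof -
  note y = rng_vertex[OF e(1)]
  have inv: "f \<in> src_inv \<Lambda> B (rng \<Lambda> e)" "f' \<in> src_inv \<Lambda> B (rng \<Lambda> e)"
    using parts(1)[OF y] f i by blast+
  consider "src \<Lambda> e \<notin> split_set \<Lambda> B w" | "rng \<Lambda> e \<in> split_set \<Lambda> B w"
    | "src \<Lambda> e \<in> split_set \<Lambda> B w" "rng \<Lambda> e \<notin> split_set \<Lambda> B w" by blast
  then show ?thesis
  proof cases
    case 1
    then have n: "num (src \<Lambda> e) = 1" by (simp add: split_num_def)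
    have "idx (swap_edge \<Lambda> B g e) = 1" if "g \<in> src_inv \<Lambda> B (rng \<Lambda> e)" for g
      using swap_edge_props[of g e] part_index_props(1)[of "swap_edge \<Lambda> B g e"] e that n
      by (auto simp: in_src_inv)
    then show ?thesis using inv by simp
  next
    case 2
    then show ?thesis using parts_singleton[OF y 2 f i] by simp
  next
    case 3
    then have "\<not> card (src_inv \<Lambda> B (rng \<Lambda> e)) \<ge> 2"
      using split_set.step[OF 3(1) edge_if_deg_std_basis[OF e(1)] e(2) refl] e(2) by blast
    then have "card (src_inv \<Lambda> B (rng \<Lambda> e)) \<le> Suc 0" by simp
    then have "f = f'" using inv card_le_Suc0_iff_eq[OF finite_src_inv[OF y]] by blast
    then show ?thesis by simp
  qed
qed

text \<open>
  The lift of an edge e to the copy of its range labelled by f starts at the copy of its source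
  labelled by the edge c on the opposite side of the commuting square \<open>f e = a c\<close>.
  For \<open>d(e) = B\<close> the square is degenerate: \<open>a = f\<close> and \<open>c = e\<close>.
\<close>

lemma split_src_square:
  assumes mor: "f \<in> mor \<Lambda>" "e \<in> mor \<Lambda>" "a \<in> mor \<Lambda>" "c \<in> mor \<Lambda>"
    and src: "src \<Lambda> f = rng \<Lambda> e" "src \<Lambda> a = rng \<Lambda> c"
    and eq: "cmp \<Lambda> f e = cmp \<Lambda> a c"
    and deg: "deg \<Lambda> f = B" "deg \<Lambda> c = B" "deg \<Lambda> a = deg \<Lambda> e" "deg \<Lambda> e \<in> std_basis"
  shows "split_src \<Lambda> B w \<E> (e, idx f) = (src \<Lambda> e, idx c)"
proof (cases "deg \<Lambda> e = B")
  case True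
  then have "e = c" using factorization_unique[of f e a c] assms by auto
  then show ?thesis using True by (simp add: split_src_def)
next
  case False
  have f: "f \<in> \<E> (rng \<Lambda> e) (idx f)" "idx f \<in> {1..num (rng \<Lambda> e)}"
    using part_index_props[OF mor(1) deg(1)] src by auto
  then have "(SOME g. g \<in> \<E> (rng \<Lambda> e) (idx f)) \<in> \<E> (rng \<Lambda> e) (idx f)" by (metis someI)
  then have "idx (swap_edge \<Lambda> B (SOME g. g \<in> \<E> (rng \<Lambda> e) (idx f)) e) = idx (swap_edge \<Lambda> B f e)"
    using swap_index_choice_independent[OF mor(2) _ f(2)] f(1) False deg by blast
  also have "swap_edge \<Lambda> B f e = c" by (rule swap_edge_eq[OF assms])
  finally show ?thesis
    using False nonempty_src_inv[OF rng_vertex[OF mor(2)]] by (simp add: split_src_def)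
qed

lemma edge_split_class:
  assumes "e \<in> edges \<Lambda>" "i \<in> {1..num (rng \<Lambda> e)}" "split_src \<Lambda> B w \<E> (e, i) \<in> verts split_gr"
  shows "(split_src \<Lambda> B w \<E> (e, i), [(e, i)], (rng \<Lambda> e, i)) \<in>
    cls (rng \<Lambda> e, i) e (split_src \<Lambda> B w \<E> (e, i))"
proof -
  have "fst (split_src \<Lambda> B w \<E> (e, i)) = src \<Lambda> e" by (simp add: split_src_def)
  then have "path_composite \<Lambda> (par_path (split_src \<Lambda> B w \<E> (e, i), [(e, i)], (rng \<Lambda> e, i))) = e"
    using assms(1) cmp_src by (simp add: path_composite_def par_path_def edges_def)
  then show ?thesis using assms
    by (simp add: split_class_def gpaths_def path_src_def path_rng_def pre_digraph.awalk_def
        pre_digraph.cas.simps) (simp add: split_graph_def)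
qed

text \<open>
  A path of degree B is a single edge, and a lifted edge of degree B starts at the copy indexed by
  the part of the edge itself, whatever the copy of its range.
\<close>

lemma split_class_deg_B_src:
  assumes \<kappa>: "\<kappa> \<in> cls v f u" and "deg \<Lambda> f = B"
  shows "u = (src \<Lambda> f, idx f)"
proof -
  obtain p where p: "\<kappa> = (u, p, v)" "pre_digraph.awalk split_gr u p v"
    using \<kappa> by (cases \<kappa>) (auto simp: split_class_def gpaths_def path_src_def path_rng_def)
  have arcs: "fst ` set p \<subseteq> edges \<Lambda>"
    using p(2) by (auto simp: pre_digraph.awalk_def split_graph_def)
  (* every edge has total degree 1, so the total degree of a path counts its edges *)
  have len: "(\<Sum>i\<in>UNIV. (\<Sum>(e, i)\<leftarrow>q. deg \<Lambda> e) $ i) = length q"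
    if "fst ` set q \<subseteq> edges \<Lambda>" for q :: "('a \<times> nat) list"
    using that by (induction q) (auto simp: edges_def sum.distrib)
  have "B = (\<Sum>(e, i)\<leftarrow>p. deg \<Lambda> e)"
    using split_class_props(4)[OF \<kappa>] assms(2) p(1) by (simp add: split_path_deg_def)
  then have "length p = 1" using len[OF arcs] sum_std_basis[OF B_std] by simp
  then obtain e i where ei: "p = [(e, i)]" by (cases p) auto
  have e: "e \<in> mor \<Lambda>" using arcs ei by (auto simp: edges_def)
  have u: "u = split_src \<Lambda> B w \<E> (e, i)"
    using p(2) ei by (auto simp: pre_digraph.awalk_def pre_digraph.cas.simps split_graph_def)
  then have "fst u = src \<Lambda> e" by (simp add: split_src_def)
  then have "f = e" using \<kappa> p(1) ei cmp_src[OF e]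
    by (auto simp: split_class_def path_composite_def par_path_def)
  then show ?thesis using u assms(2) by (simp add: split_src_def)
qed

end

section \<open>Two-sided paths\<close>

definition int_vec :: "nat ^ 'k \<Rightarrow> int ^ 'k :: finite" where
  "int_vec m = (\<chi> i. int (m $ i))"

lemma mor_Omega_bar [simp]: "(m, n) \<in> mor Omega_bar \<longleftrightarrow> m \<le> n"
  by (simp add: Omega_bar_def)

lemma deg_Omega_bar [simp]: "deg Omega_bar (m, n) = (\<chi> i. nat (n $ i - m $ i))"
  by (simp add: Omega_bar_def)

lemma le_add_int_vec [simp]: "m \<le> m + int_vec b"
  by (simp add: less_eq_vec_def int_vec_def)

lemma diff_int_vec_le [simp]: "m - int_vec b \<le> m"
  by (simp add: less_eq_vec_def int_vec_def)

lemma vec_add_le_cancel [simp]: "m + c \<le> n + c \<longleftrightarrow> m \<le> n" for m n c :: "int ^ 'k :: finite"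
  by (simp add: less_eq_vec_def)

lemma deg_Omega_bar_add [simp]: "deg Omega_bar (m, m + int_vec b) = b"
  by (simp add: int_vec_def vec_eq_iff)

lemma X_barD:
  assumes "x \<in> X_bar \<Lambda>" "m \<le> n"
  shows "x (m, n) \<in> mor \<Lambda>" "rng \<Lambda> (x (m, n)) = x (m, m)" "src \<Lambda> (x (m, n)) = x (n, n)"
    "deg \<Lambda> (x (m, n)) = deg Omega_bar (m, n)"
    "n \<le> p \<Longrightarrow> cmp \<Lambda> (x (m, n)) (x (n, p)) = x (m, p)"
proof -
  have x: "x (rng Omega_bar (m, n)) = rng \<Lambda> (x (m, n))"
      "x (src Omega_bar (m, n)) = src \<Lambda> (x (m, n))" "x (m, n) \<in> mor \<Lambda>"
      "deg \<Lambda> (x (m, n)) = deg Omega_bar (m, n)"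
    using assms by (auto simp: X_bar_def kgraph_morphisms_def PiE_iff)
  then show "x (m, n) \<in> mor \<Lambda>" "deg \<Lambda> (x (m, n)) = deg Omega_bar (m, n)" by blast+
  show "rng \<Lambda> (x (m, n)) = x (m, m)" "src \<Lambda> (x (m, n)) = x (n, n)"
    using x(1,2) by (simp_all add: Omega_bar_def)
  assume "n \<le> p"
  then have "(n, p) \<in> mor Omega_bar" "src Omega_bar (m, n) = rng Omega_bar (n, p)"
    by (simp_all add: Omega_bar_def)
  moreover have "(m, n) \<in> mor Omega_bar" using assms(2) by simp
  ultimately have "x (cmp Omega_bar (m, n) (n, p)) = cmp \<Lambda> (x (m, n)) (x (n, p))"
    using assms(1) unfolding X_bar_def kgraph_morphisms_def by blast
  then show "cmp \<Lambda> (x (m, n)) (x (n, p)) = x (m, p)" by (simp add: Omega_bar_def)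
qed

lemma X_barI:
  assumes "x \<in> extensional (mor Omega_bar)"
    and "\<And>m n. m \<le> n \<Longrightarrow> x (m, n) \<in> mor \<Lambda>"
    and "\<And>m n. m \<le> n \<Longrightarrow> rng \<Lambda> (x (m, n)) = x (m, m)"
    and "\<And>m n. m \<le> n \<Longrightarrow> src \<Lambda> (x (m, n)) = x (n, n)"
    and "\<And>m n. m \<le> n \<Longrightarrow> deg \<Lambda> (x (m, n)) = deg Omega_bar (m, n)"
    and "\<And>m n p. m \<le> n \<Longrightarrow> n \<le> p \<Longrightarrow> cmp \<Lambda> (x (m, n)) (x (n, p)) = x (m, p)"
  shows "x \<in> X_bar \<Lambda>"
  using assms by (auto simp: X_bar_def kgraph_morphisms_def PiE_iff Omega_bar_def)

text \<open>
  A cylinder over a morphism of the wrong degree is empty, and the others are generators.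
\<close>

lemma openin_cylinder:
  assumes "mn \<in> mor Omega_bar"
  shows "openin (X_bar_topology \<Lambda>) (cylinder \<Lambda> mn \<kappa>)"
proof (cases "\<kappa> \<in> mor_deg \<Lambda> (deg Omega_bar mn)")
  case True
  then show ?thesis using assms
    unfolding X_bar_topology_def by (intro topology_generated_by_Basis) blast
next
  case False
  then have "cylinder \<Lambda> mn \<kappa> = {}"
    using assms X_barD(1,4)[of _ \<Lambda> "fst mn" "snd mn"]
    by (cases mn) (auto simp: cylinder_def mor_deg_def)
  then show ?thesis by simp
qed

lemma topspace_X_bar [simp]: "topspace (X_bar_topology \<Lambda>) = X_bar \<Lambda>"
proof
  show "topspace (X_bar_topology \<Lambda>) \<subseteq> X_bar \<Lambda>"
    by (auto simp: X_bar_topology_def cylinder_def)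
  show "X_bar \<Lambda> \<subseteq> topspace (X_bar_topology \<Lambda>)"
  proof
    fix x assume "x \<in> X_bar \<Lambda>"
    then have "x \<in> cylinder \<Lambda> (0, 0) (x (0, 0))" by (simp add: cylinder_def)
    then show "x \<in> topspace (X_bar_topology \<Lambda>)"
      using openin_subset[OF openin_cylinder[of "(0, 0)" \<Lambda> "x (0, 0)"]] by auto
  qed
qed

text \<open>
  A map is continuous if each coordinate of the image depends on finitely many coordinates of the
  argument, as for a sliding block code.
\<close>

lemma continuous_map_finite_dependence:
  assumes F: "F \<in> X_bar \<Lambda> \<rightarrow> X_bar \<Gamma>"
    and dep: "\<And>mn. mn \<in> mor Omega_bar \<Longrightarrow> \<exists>N. finite N \<and> N \<subseteq> mor Omega_bar \<and>
      (\<forall>x \<in> X_bar \<Lambda>. \<forall>x' \<in> X_bar \<Lambda>. (\<forall>a \<in> N. x' a = x a) \<longrightarrow> F x' mn = F x mn)"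
  shows "continuous_map (X_bar_topology \<Lambda>) (X_bar_topology \<Gamma>) F"
proof -
  have "openin (X_bar_topology \<Lambda>) (F -` U \<inter> X_bar \<Lambda>)"
    if U: "U = cylinder \<Gamma> mn \<kappa>" and mn: "mn \<in> mor Omega_bar" for U mn \<kappa>
  proof (subst openin_subopen, intro ballI)
    fix x assume x: "x \<in> F -` U \<inter> X_bar \<Lambda>"
    obtain N where N: "finite N" "N \<subseteq> mor Omega_bar"
      and agree: "\<And>x'. x' \<in> X_bar \<Lambda> \<Longrightarrow> (\<forall>a \<in> N. x' a = x a) \<Longrightarrow> F x' mn = F x mn"
      using dep[OF mn] x by blast
    let ?T = "(\<Inter>a \<in> N. cylinder \<Lambda> a (x a)) \<inter> topspace (X_bar_topology \<Lambda>)"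
    have "openin (X_bar_topology \<Lambda>) ?T"
      using N by (intro openin_INT) (auto intro: openin_cylinder)
    moreover have "x \<in> ?T" using x by (auto simp: cylinder_def)
    moreover have "?T \<subseteq> F -` U \<inter> X_bar \<Lambda>"
    proof
      fix x' assume x': "x' \<in> ?T"
      then have "F x' mn = F x mn" using agree by (auto simp: cylinder_def)
      then show "x' \<in> F -` U \<inter> X_bar \<Lambda>" using x x' F U by (auto simp: cylinder_def)
    qed
    ultimately show "\<exists>T. openin (X_bar_topology \<Lambda>) T \<and> x \<in> T \<and> T \<subseteq> F -` U \<inter> X_bar \<Lambda>"
      by blast
  qed
  moreover have "F ` X_bar \<Lambda> \<subseteq> topspace (X_bar_topology \<Gamma>)" using F by auto
  ultimately show ?thesis
    unfolding X_bar_topology_def[of \<Gamma>]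
    by (intro continuous_on_generated_topo) (auto simp: X_bar_topology_def[of \<Gamma>])
qed

section \<open>Lifting and projecting two-sided paths\<close>

context partitioned_kgraph
begin

abbreviation "\<Gamma> \<equiv> limar_split \<Lambda> B w \<E>"

text \<open>The index of the copy of \<open>x(n, n)\<close> that the lift of x visits.\<close>

definition label :: "((int ^ 'k) \<times> (int ^ 'k) \<Rightarrow> 'a) \<Rightarrow> int ^ 'k \<Rightarrow> nat" where
  "label x n = idx (x (n - int_vec B, n))"

definition lift :: "((int ^ 'k) \<times> (int ^ 'k) \<Rightarrow> 'a) \<Rightarrow>
    (int ^ 'k) \<times> (int ^ 'k) \<Rightarrow> ('a \<times> nat, 'a \<times> nat) gpath set" where
  "lift x = restrict (\<lambda>(m, n). cls (x (m, m), label x m) (x (m, n)) (x (n, n), label x n))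
     (mor Omega_bar)"

definition project :: "((int ^ 'k) \<times> (int ^ 'k) \<Rightarrow> ('a \<times> nat, 'a \<times> nat) gpath set) \<Rightarrow>
    (int ^ 'k) \<times> (int ^ 'k) \<Rightarrow> 'a" where
  "project y = restrict (\<lambda>mn. base_mor \<Lambda> (y mn)) (mor Omega_bar)"

lemma lift_apply:
  "m \<le> n \<Longrightarrow> lift x (m, n) = cls (x (m, m), label x m) (x (m, n)) (x (n, n), label x n)"
  by (simp add: lift_def)

lemma project_apply: "m \<le> n \<Longrightarrow> project y (m, n) = base_mor \<Lambda> (y (m, n))"
  by (simp add: project_def)

lemma deg_edge_into:
  assumes "x \<in> X_bar \<Lambda>"
  shows "x (n - int_vec b, n) \<in> mor \<Lambda>" "deg \<Lambda> (x (n - int_vec b, n)) = b"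
    "src \<Lambda> (x (n - int_vec b, n)) = x (n, n)"
  using X_barD[OF assms diff_int_vec_le[of n b]] deg_Omega_bar_add[of "n - int_vec b" b] by auto

lemma label_in_verts:
  assumes "x \<in> X_bar \<Lambda>"
  shows "(x (n, n), label x n) \<in> verts split_gr"
  using part_index_in_verts[of "x (n - int_vec B, n)"] deg_edge_into[OF assms]
  by (simp add: label_def)

text \<open>
  The labels are compatible along each edge of x: the square of degree \<open>b + B\<close> of x at \<open>m - B\<close> has
  the edges that define the labels at m and \<open>m + b\<close> as its sides of degree B.
\<close>

lemma split_src_label:
  assumes x: "x \<in> X_bar \<Lambda>" and b: "b \<in> std_basis"
  shows "split_src \<Lambda> B w \<E> (x (m, m + int_vec b), label x m) =
    (x (m + int_vec b, m + int_vec b), label x (m + int_vec b))"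
proof -
  let ?m' = "m + int_vec b" and ?l = "m - int_vec B"
  let ?l' = "?m' - int_vec B"
  have le: "?l \<le> m" "m \<le> ?m'" "?l \<le> ?l'" "?l' \<le> ?m'"
    by (auto simp: less_eq_vec_def int_vec_def)
  have "deg Omega_bar (?l, ?l') = b" by (simp add: vec_eq_iff int_vec_def)
  moreover have "cmp \<Lambda> (x (?l, m)) (x (m, ?m')) = cmp \<Lambda> (x (?l, ?l')) (x (?l', ?m'))"
    using le by (simp add: X_barD(5)[OF x])
  ultimately have "split_src \<Lambda> B w \<E> (x (m, ?m'), idx (x (?l, m))) =
      (src \<Lambda> (x (m, ?m')), idx (x (?l', ?m')))"
    using deg_edge_into[OF x, of m B] deg_edge_into[OF x, of ?m' B] b
      X_barD[OF x le(2)] X_barD[OF x le(3)] X_barD[OF x le(4)]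
    by (intro split_src_square[where a = "x (?l, ?l')"]) (simp_all only: deg_Omega_bar_add)
  then show ?thesis using X_barD(3)[OF x le(2)] by (simp add: label_def)
qed

text \<open>
  A lifted path is built one edge at a time, from n back towards m, along any staircase of basis
  vectors; the compatibility of labels lets consecutive lifted edges be composed.
\<close>

lemma lift_nonempty:
  assumes x: "x \<in> X_bar \<Lambda>" and "m \<le> n"
  shows "cls (x (m, m), label x m) (x (m, n)) (x (n, n), label x n) \<noteq> {}"
  using assms(2)
proof (induction "\<Sum>i\<in>UNIV. nat (n $ i - m $ i)" arbitrary: m rule: less_induct)
  case less
  show ?case
  proof (cases "m = n")
    case True
    then show ?thesis using split_class_id[OF label_in_verts[OF x, of n]] by auto
  next
    case False
    then obtain j where j: "m $ j < n $ j"
      using less.prems by (metis less_eq_vec_def order_le_less vec_eq_iff)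
    let ?b = "axis j 1 :: nat ^ 'k"
    let ?m' = "m + int_vec ?b"
    have b: "?b \<in> std_basis" by (simp add: std_basis_def)
    have m': "?m' \<le> n" using j less.prems by (auto simp: less_eq_vec_def int_vec_def axis_def)
    have "(\<Sum>i\<in>UNIV. nat (n $ i - ?m' $ i)) < (\<Sum>i\<in>UNIV. nat (n $ i - m $ i))"
      by (rule sum_strict_mono_ex1) (use j in \<open>auto simp: int_vec_def axis_def\<close>)
    from less.hyps[OF this m'] obtain \<mu>
      where \<mu>: "\<mu> \<in> cls (x (?m', ?m'), label x ?m') (x (?m', n)) (x (n, n), label x n)" by blast
    note e = X_barD[OF x le_add_int_vec[of m ?b]]
    have "deg \<Lambda> (x (m, ?m')) \<in> std_basis" using e(4) b by (simp only: deg_Omega_bar_add)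
    then have edge: "x (m, ?m') \<in> edges \<Lambda>" using e(1) by (rule edge_if_deg_std_basis[rotated])
    moreover have "label x m \<in> {1..num (rng \<Lambda> (x (m, ?m')))}"
      using label_in_verts[OF x, of m] e(2) by (simp add: split_graph_def)
    ultimately obtain \<kappa> where \<kappa>:
      "\<kappa> \<in> cls (x (m, m), label x m) (x (m, ?m')) (x (?m', ?m'), label x ?m')"
      using edge_split_class[of "x (m, ?m')" "label x m"] split_src_label[OF x b, of m]
        label_in_verts[OF x, of ?m'] e(2) by auto
    then show ?thesis
      using split_class_cmp[OF \<kappa> \<mu>] X_barD(5)[OF x le_add_int_vec m'] by auto
  qed
qed

lemma lift_in_X_bar:
  assumes x: "x \<in> X_bar \<Lambda>"
  shows "lift x \<in> X_bar \<Gamma>"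
proof (rule X_barI)
  fix m n :: "int ^ 'k" assume mn: "m \<le> n"
  note ne = lift_nonempty[OF x mn]
  show "lift x (m, n) \<in> mor \<Gamma>" 
    unfolding lift_apply[OF mn] limar_split_mor using ne by blast
  show "rng \<Gamma> (lift x (m, n)) = lift x (m, m)"
    using limar_split_rng[OF ne] mn by (simp add: lift_apply)
  show "src \<Gamma> (lift x (m, n)) = lift x (n, n)"
    using limar_split_src[OF ne] mn by (simp add: lift_apply)
  show "deg \<Gamma> (lift x (m, n)) = deg Omega_bar (m, n)"
    using limar_split_deg[OF ne] X_barD(4)[OF x mn] mn by (simp add: lift_apply)
  fix p assume np: "n \<le> p"
  show "cmp \<Gamma> (lift x (m, n)) (lift x (n, p)) = lift x (m, p)"
    using limar_split_cmp[OF ne lift_nonempty[OF x np]] X_barD(5)[OF x mn np] mn np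
    by (simp add: lift_apply order.trans[OF mn np])
qed (simp add: lift_def)

lemma project_lift:
  assumes x: "x \<in> X_bar \<Lambda>"
  shows "project (lift x) = x"
proof (rule extensionalityI[of _ "mor Omega_bar"])
  show "x \<in> extensional (mor Omega_bar)"
    using x by (auto simp: X_bar_def kgraph_morphisms_def PiE_iff)
  fix mn :: "(int ^ 'k) \<times> (int ^ 'k)" assume "mn \<in> mor Omega_bar"
  then show "project (lift x) mn = x mn"
    by (cases mn) (simp add: project_apply lift_apply base_mor_split_class lift_nonempty[OF x])
qed (simp add: project_def)

text \<open>
  The vertex \<open>y(n, n)\<close> is a copy \<open>V n\<close> of a vertex of \<open>\<Lambda>\<close>.  Since classes determine their ends,
  the values \<open>y(m, n)\<close> for all m and n share these copies.
\<close>

lemma X_bar_split_coordinates: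
  assumes y: "y \<in> X_bar \<Gamma>"
  obtains V where "\<And>m n. m \<le> n \<Longrightarrow> y (m, n) = cls (V m) (project y (m, n)) (V n)"
    and "\<And>m n. m \<le> n \<Longrightarrow> y (m, n) \<noteq> {}"
proof -
  have ne: "y (m, n) \<noteq> {}" if "m \<le> n" for m n
    using X_barD(1)[OF y that] limar_split_mor[of "y (m, n)"] by blast
  have "\<exists>u. y (n, n) = cls u (fst u) u" for n
  proof -
    obtain v f u where "y (n, n) = cls v f u"
      using X_barD(1)[OF y order.refl] limar_split_mor[of "y (n, n)"] by blast
    then have "y (n, n) = cls u (fst u) u"
      using limar_split_src[of B w \<E> v f u] X_barD(3)[OF y order.refl, of n] ne[of n n] by simp
    then show ?thesis by blast
  qed
  then obtain V where V: "\<And>n. y (n, n) = cls (V n) (fst (V n)) (V n)" by metis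
  have "y (m, n) = cls (V m) (project y (m, n)) (V n)" if mn: "m \<le> n" for m n
  proof -
    obtain v f u where yf: "y (m, n) = cls v f u"
      using X_barD(1)[OF y mn] limar_split_mor[of "y (m, n)"] by blast
    note nef = ne[OF mn, unfolded yf]
    have "y (m, m) = cls v (fst v) v" "y (n, n) = cls u (fst u) u"
      using limar_split_rng[OF nef] limar_split_src[OF nef] X_barD(2,3)[OF y mn] yf by simp_all
    then have "v = V m" "u = V n"
      using split_class_inject V ne[OF order.refl] by metis+
    moreover have "project y (m, n) = f"
      using mn yf base_mor_split_class[OF nef] by (simp add: project_apply)
    ultimately show ?thesis using yf by simp
  qed
  then show thesis using that ne by blast
qed

text \<open>
  The edge of degree B arriving at n determines the copy \<open>V n\<close>, so y has no freedom beyond its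
  projection.
\<close>

lemma
  assumes y: "y \<in> X_bar \<Gamma>"
  shows project_in_X_bar: "project y \<in> X_bar \<Lambda>" and lift_project: "lift (project y) = y"
proof -
  obtain V where V: "\<And>m n. m \<le> n \<Longrightarrow> y (m, n) = cls (V m) (project y (m, n)) (V n)"
    and ne: "\<And>m n. m \<le> n \<Longrightarrow> cls (V m) (project y (m, n)) (V n) \<noteq> {}"
    using X_bar_split_coordinates[OF y] by metis
  have props: "project y (m, n) \<in> mor \<Lambda>" "rng \<Lambda> (project y (m, n)) = fst (V m)"
    "src \<Lambda> (project y (m, n)) = fst (V n)" if mn: "m \<le> n" for m n
  proof -
    obtain \<kappa> where "\<kappa> \<in> cls (V m) (project y (m, n)) (V n)" using ne[OF mn] by blast
    then show "project y (m, n) \<in> mor \<Lambda>" "rng \<Lambda> (project y (m, n)) = fst (V m)"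
      "src \<Lambda> (project y (m, n)) = fst (V n)"
      by (fact split_class_props(1-3))+
  qed
  have deg: "deg \<Lambda> (project y (m, n)) = deg Omega_bar (m, n)" if "m \<le> n" for m n
    using limar_split_deg[OF ne[OF that]] X_barD(4)[OF y that] V[OF that] by simp
  have vertex: "project y (n, n) = fst (V n)" for n
  proof -
    have "project y (n, n) \<in> vertices \<Lambda>"
      using props(1)[of n n] deg[of n n] by (simp add: mor_deg_def vec_eq_iff)
    then show ?thesis using vertex_is_identity(2) props(3)[of n n] by simp
  qed
  show "project y \<in> X_bar \<Lambda>"
  proof (rule X_barI)
    fix m n p :: "int ^ 'k" assume mn: "m \<le> n" and np: "n \<le> p"
    have mp: "m \<le> p" using mn np by (rule order.trans)
    have "cls (V m) (cmp \<Lambda> (project y (m, n)) (project y (n, p))) (V p) =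
        cls (V m) (project y (m, p)) (V p)"
      using limar_split_cmp[OF ne[OF mn] ne[OF np]] X_barD(5)[OF y mn np] V[OF mn] V[OF np] V[OF mp]
      by simp
    then show "cmp \<Lambda> (project y (m, n)) (project y (n, p)) = project y (m, p)"
      using split_class_inject ne[OF mp] by metis
  qed (simp_all add: props vertex deg del: deg_Omega_bar, simp add: project_def)
  have V_eq: "V n = (project y (n, n), label (project y) n)" for n
  proof -
    let ?l = "n - int_vec B"
    have "deg \<Lambda> (project y (?l, n)) = B"
      using deg[OF diff_int_vec_le] deg_Omega_bar_add[of ?l B] by simp
    moreover obtain \<kappa> where "\<kappa> \<in> cls (V ?l) (project y (?l, n)) (V n)"
      using ne[OF diff_int_vec_le] by blast
    ultimately have "V n = (src \<Lambda> (project y (?l, n)), idx (project y (?l, n)))"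
      by (rule split_class_deg_B_src[rotated])
    then show ?thesis using props(3)[OF diff_int_vec_le, of n B] vertex by (simp add: label_def)
  qed
  show "lift (project y) = y"
  proof (rule extensionalityI[of _ "mor Omega_bar"])
    show "y \<in> extensional (mor Omega_bar)"
      using y by (auto simp: X_bar_def kgraph_morphisms_def PiE_iff)
    fix mn :: "(int ^ 'k) \<times> (int ^ 'k)" assume "mn \<in> mor Omega_bar"
    then show "lift (project y) mn = y mn"
      by (cases mn) (simp add: lift_apply V V_eq[symmetric])
  qed (simp add: lift_def)
qed

lemma lift_shift: "shift_bar m (lift x) = lift (shift_bar m x)"
proof (rule ext)
  fix a :: "(int ^ 'k) \<times> (int ^ 'k)"
  obtain p q where a: "a = (p, q)" by (cases a)
  have shift: "shift_bar m z (p, q) = z (p + int_vec m, q + int_vec m)" if "p \<le> q"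
    for z :: "(int ^ 'k) \<times> (int ^ 'k) \<Rightarrow> 'b" and p q
    using that by (simp add: shift_bar_def Let_def int_vec_def)
  have label: "label (shift_bar m x) p = label x (p + int_vec m)" for p
    by (simp add: label_def shift algebra_simps)
  show "shift_bar m (lift x) a = lift (shift_bar m x) a"
  proof (cases "p \<le> q")
    case True
    then show ?thesis by (simp add: a shift lift_apply label)
  next
    case False
    then show ?thesis by (simp add: a shift_bar_def lift_def Let_def)
  qed
qed

lemma homeomorphic_maps_lift_project:
  "homeomorphic_maps (X_bar_topology \<Lambda>) (X_bar_topology \<Gamma>) lift project"
proof -
  have "continuous_map (X_bar_topology \<Lambda>) (X_bar_topology \<Gamma>) lift"
  proof (rule continuous_map_finite_dependence)
    fix mn :: "(int ^ 'k) \<times> (int ^ 'k)" assume "mn \<in> mor Omega_bar"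
    then obtain m n where mn: "mn = (m, n)" "m \<le> n" by (cases mn) auto
    let ?N = "{(m, m), (m, n), (n, n), (m - int_vec B, m), (n - int_vec B, n)}"
    have "?N \<subseteq> mor Omega_bar" using mn by simp
    moreover have "lift x' mn = lift x mn" if "\<forall>a \<in> ?N. x' a = x a" for x x'
      using that mn by (simp add: lift_apply label_def)
    ultimately show "\<exists>N. finite N \<and> N \<subseteq> mor Omega_bar \<and> (\<forall>x \<in> X_bar \<Lambda>. \<forall>x' \<in> X_bar \<Lambda>.
        (\<forall>a \<in> N. x' a = x a) \<longrightarrow> lift x' mn = lift x mn)"
      by (intro exI[of _ ?N]) blast
  qed (simp add: lift_in_X_bar)
  moreover have "continuous_map (X_bar_topology \<Gamma>) (X_bar_topology \<Lambda>) project"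
  proof (rule continuous_map_finite_dependence)
    fix mn :: "(int ^ 'k) \<times> (int ^ 'k)" assume mn: "mn \<in> mor Omega_bar"
    show "\<exists>N. finite N \<and> N \<subseteq> mor Omega_bar \<and> (\<forall>y \<in> X_bar \<Gamma>. \<forall>y' \<in> X_bar \<Gamma>.
        (\<forall>a \<in> N. y' a = y a) \<longrightarrow> project y' mn = project y mn)"
      using mn by (intro exI[of _ "{mn}"]) (auto simp: project_def)
  qed (simp add: project_in_X_bar)
  ultimately show ?thesis
    by (simp add: homeomorphic_maps_def project_lift lift_project)
qed

end

text \<open>
  Row-finiteness bounds the edges with a given range; finitely many possible ranges turn this into
  a bound on the edges with a given source.
\<close>

lemma (in kgraph) finite_src_inv_if_row_finite:
  assumes "row_finite \<Lambda>" "finite (vertices \<Lambda>)" "B \<in> std_basis"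
  shows "finite (src_inv \<Lambda> B v)"
proof (rule finite_subset)
  show "src_inv \<Lambda> B v \<subseteq> (\<Union>u \<in> vertices \<Lambda>. {\<kappa> \<in> mor_deg \<Lambda> B. rng \<Lambda> \<kappa> = u})"
    using rng_vertex by (auto simp: src_inv_def edges_def mor_deg_def)
  show "finite (\<Union>u \<in> vertices \<Lambda>. {\<kappa> \<in> mor_deg \<Lambda> B. rng \<Lambda> \<kappa> = u})"
    using assms by (auto simp: row_finite_def)
qed

theorem corollary4p12:
  fixes \<Lambda> :: "('a, 'k :: finite) graded_cat"
    and B :: "nat ^ 'k"
    and w :: 'a
    and \<E> :: "'a \<Rightarrow> nat \<Rightarrow> 'a set"
    and \<Gamma> :: "(('a \<times> nat, 'a \<times> nat) gpath set, 'k) graded_cat"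
  assumes "kgraph \<Lambda>"
    and "source_free \<Lambda>" and "sink_free \<Lambda>" and "row_finite \<Lambda>"
    and "finite (vertices \<Lambda>)"
    and "B \<in> std_basis"
    and "w \<in> vertices \<Lambda>" and "card (src_inv \<Lambda> B w) \<ge> 2"
    and "split_partition \<Lambda> B w \<E>"
    and "\<Gamma> = limar_split \<Lambda> B w \<E>"
  shows "\<exists>h. homeomorphic_map (X_bar_topology \<Lambda>) (X_bar_topology \<Gamma>) h \<and>
    (\<forall>m :: nat ^ 'k. \<forall>x \<in> X_bar \<Lambda>. shift_bar m (h x) = h (shift_bar m x))"
proof -
  interpret kgraph \<Lambda> by (rule assms(1))
  interpret partitioned_kgraph \<Lambda> B w \<E>
  proof
    fix v assume "v \<in> vertices \<Lambda>"
    then obtain e where "e \<in> mor_deg \<Lambda> B" "src \<Lambda> e = v"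
      using assms(3,6) unfolding sink_free_def by blast
    then have "e \<in> src_inv \<Lambda> B v"
      using edge_if_deg_std_basis assms(6) by (auto simp: src_inv_def mor_deg_def)
    then show "src_inv \<Lambda> B v \<noteq> {}" by blast
  qed (use assms finite_src_inv_if_row_finite in auto)
  show ?thesis
    using homeomorphic_maps_lift_project lift_shift assms(10) homeomorphic_maps_imp_map by blast
qed

end
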